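(* There exist absolute constants $c_1>0$ and $c_2>0$ such that, as $\log(b/a)\to\infty$ (that is, for all $0<a<b<\infty$ with $\log(b/a)$ sufficiently large), $$4-\frac{c_1}{\left[\log\frac{b}{a}\right]^2}\le d(a,b)\le 4-\frac{c_2}{\left[\log\frac{b}{a}\right]^2}.$$
   Context: For $0<a<b<\infty$, $d(a,b)$ denotes the smallest constant such that $$\int_a^b\left(\frac{1}{x}\int_a^x f(t)\,dt\right)^2 dx\leq d(a,b)\int_a^b [f(x)]^2\,dx$$ holds for every real-valued $f\in L^2[a,b]$. $\log$ denotes the natural logarithm. *)

theory Defs
  imports "HOL-Analysis.Analysis"
begin

text \<open>Representatives of the elements of the real space \<open>L\<^sup>2[a,b]\<close>: Lebesgue measurable on
  \<open>[a,b]\<close> with integrable square. Values outside \<open>[a,b]\<close> are irrelevant.\<close>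

definition L2_on :: "real \<Rightarrow> real \<Rightarrow> (real \<Rightarrow> real) set" where
  "L2_on a b = {f. set_borel_measurable lebesgue {a..b} f \<and>
                   set_integrable lebesgue {a..b} (\<lambda>x. (f x)\<^sup>2)}"

text \<open>For \<open>0 < a < b\<close> and \<open>f\<close> in \<open>L\<^sup>2[a,b]\<close> all integrals below converge: \<open>f\<close> is integrable on
  the bounded interval \<open>[a,b]\<close>, so the averages form a continuous function on \<open>[a,b]\<close>. Hence
  the convention that a divergent integral is \<open>0\<close> plays no role.\<close>

definition hardy_bound :: "real \<Rightarrow> real \<Rightarrow> real \<Rightarrow> bool" where
  "hardy_bound a b C \<longleftrightarrow>
     (\<forall>f \<in> L2_on a b.
        (LINT x:{a..b}|lebesgue. (1 / x * (LINT t:{a..x}|lebesgue. f t))\<^sup>2)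
          \<le> C * (LINT x:{a..b}|lebesgue. (f x)\<^sup>2))"

text \<open>The smallest constant exists for \<open>0 < a < b\<close>: the admissible constants form a closed set
  that is nonempty and bounded below by \<open>0\<close>.\<close>

definition hardy_const :: "real \<Rightarrow> real \<Rightarrow> real" where
  "hardy_const a b = (LEAST C. hardy_bound a b C)"

end

theory Submission
  imports Defs
begin

text \<open>For a test function \<open>\<phi>\<close> with \<open>\<phi> a = 0\<close>, \<open>\<phi>' > 0\<close> and \<open>\<phi>'' = - \<mu> \<phi> / x\<^sup>2\<close>, the Cauchy--Schwarz
  inequality with weight \<open>\<phi>'\<close> followed by Tonelli's theorem shows that \<open>1 / \<mu>\<close> is an admissible
  constant. Such functions are \<open>\<phi> x = sqrt x * sin (\<omega> ln (x / a))\<close> with \<open>\<mu> = 1/4 + \<omega>\<^sup>2\<close>, and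
  \<open>\<phi>'\<close> stays positive up to \<open>\<omega> ln (b / a) = \<pi>/2\<close>; this gives the upper bound. If
  \<open>\<omega> ln (b / a) = \<pi>\<close> instead, then \<open>\<phi>\<close> vanishes at both ends, integration by parts gives
  \<open>\<integral> \<phi>'\<^sup>2 = \<mu> \<integral> \<phi>\<^sup>2 / x\<^sup>2\<close>, and \<open>f = \<phi>'\<close> yields the lower bound.\<close>

section \<open>Auxiliary facts on Lebesgue integration\<close>

lemma sigma_finite_measure_completion:
  assumes "sigma_finite_measure M"
  shows "sigma_finite_measure (completion M)"
proof -
  obtain A where "countable A" "A \<subseteq> sets M" "\<Union>A = space M" "\<forall>a\<in>A. emeasure M a \<noteq> \<infinity>"
    using sigma_finite_measure.sigma_finite_countable[OF assms] by blast
  then show ?thesis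
    by (intro sigma_finite_measure.intro exI[of _ A]) auto
qed

lemma set_lebesgue_integral_FTC:
  fixes f F :: "real \<Rightarrow> real"
  assumes "a \<le> x" "continuous_on {a..x} f"
    and "\<And>t. t \<in> {a..x} \<Longrightarrow> (F has_real_derivative f t) (at t)"
  shows "set_integrable lebesgue {a..x} f" "(LINT t:{a..x}|lebesgue. f t) = F x - F a"
proof -
  show i: "set_integrable lebesgue {a..x} f"
    using absolutely_integrable_continuous_real[OF assms(2)] .
  have "(f has_integral F x - F a) {a..x}"
    using assms by (intro fundamental_theorem_of_calculus)
      (auto simp: has_real_derivative_iff_has_vector_derivative[symmetric]
            intro: has_field_derivative_at_within)
  then show "(LINT t:{a..x}|lebesgue. f t) = F x - F a"
    using set_lebesgue_integral_eq_integral(2)[OF i] by (simp add: integral_unique)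
qed

text \<open>The integral of \<open>(f - r * p)\<^sup>2 / p\<close> is nonnegative for every real
  \<open>r\<close>. Expanding it at its minimiser, the quotient of the integrals of \<open>f\<close>
  and \<open>p\<close>, gives the inequality.\<close>

lemma set_integral_Cauchy_Schwarz_weighted:
  fixes f p :: "'a \<Rightarrow> real"
  assumes f: "set_integrable M A f" and p: "set_integrable M A p"
    and q: "set_integrable M A (\<lambda>t. (f t)\<^sup>2 / p t)"
    and pos: "\<And>t. t \<in> A \<Longrightarrow> 0 < p t" and P: "0 < (LINT t:A|M. p t)"
  shows "(LINT t:A|M. f t)\<^sup>2 \<le> (LINT t:A|M. p t) * (LINT t:A|M. (f t)\<^sup>2 / p t)"
proof -
  let ?F = "LINT t:A|M. f t" and ?P = "LINT t:A|M. p t"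
  define r where "r = ?F / ?P"
  have "(LINT t:A|M. (f t)\<^sup>2 / p t - (2 * r) * f t + r\<^sup>2 * p t)
        = (LINT t:A|M. (f t)\<^sup>2 / p t) - 2 * r * ?F + r\<^sup>2 * ?P"
    using f p q by simp
  moreover have "0 \<le> (LINT t:A|M. (f t)\<^sup>2 / p t - (2 * r) * f t + r\<^sup>2 * p t)"
    unfolding set_lebesgue_integral_def
  proof (intro integral_nonneg_AE AE_I2)
    fix t
    show "0 \<le> indicator A t *\<^sub>R ((f t)\<^sup>2 / p t - (2 * r) * f t + r\<^sup>2 * p t)"
    proof (cases "t \<in> A")
      case True
      have "(f t)\<^sup>2 / p t - (2 * r) * f t + r\<^sup>2 * p t = (f t - r * p t)\<^sup>2 / p t"
        using pos[OF True] by (simp add: field_simps power2_eq_square)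
      then show ?thesis using pos[OF True] by simp
    qed simp
  qed
  moreover have "2 * r * ?F - r\<^sup>2 * ?P = ?F\<^sup>2 / ?P"
    using P by (simp add: r_def field_simps power2_eq_square)
  ultimately have "?F\<^sup>2 / ?P \<le> (LINT t:A|M. (f t)\<^sup>2 / p t)" by linarith
  then show ?thesis using P by (simp add: field_simps)
qed

text \<open>Constants are integrable on a bounded interval, so \<open>1 + (f x)\<^sup>2\<close> is
  an integrable majorant.\<close>

lemma L2_on_set_integrable:
  assumes "f \<in> L2_on a b"
  shows "set_integrable lebesgue {a..b} f"
proof (rule set_integrable_bound)
  show "set_integrable lebesgue {a..b} (\<lambda>x. 1 + (f x)\<^sup>2)"
    using assms by (intro set_integral_add) (auto simp: L2_on_def absolutely_integrable_continuous_real)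
  show "set_borel_measurable lebesgue {a..b} f"
    using assms by (simp add: L2_on_def)
  have "\<bar>y\<bar> \<le> 1 + y\<^sup>2" for y :: real
    using zero_le_power2[of "\<bar>y\<bar> - 1"] by (simp add: power2_eq_square algebra_simps)
  then show "AE x in lebesgue. x \<in> {a..b} \<longrightarrow> norm (f x) \<le> norm (1 + (f x)\<^sup>2)"
    by simp
qed

text \<open>Brings a Tonelli estimate back to the Bochner integral. If \<open>g\<close> is not
  integrable, its integral is 0 by convention and \<open>0 \<le> B\<close> settles the
  claim.\<close>

lemma set_integral_le_nn_integral_bound:
  fixes g :: "'a \<Rightarrow> real"
  assumes "0 \<le> B" and "\<And>x. x \<in> A \<Longrightarrow> 0 \<le> g x"
    and "(\<integral>\<^sup>+x. ennreal (g x) * indicator A x \<partial>M) \<le> ennreal B"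
  shows "(LINT x:A|M. g x) \<le> B"
proof (cases "set_integrable M A g")
  case True
  have "ennreal (LINT x:A|M. g x) = (\<integral>\<^sup>+x. ennreal (indicator A x *\<^sub>R g x) \<partial>M)"
    unfolding set_lebesgue_integral_def using True assms(2)
    by (intro nn_integral_eq_integral[symmetric]) (auto simp: set_integrable_def indicator_def)
  also have "\<dots> = (\<integral>\<^sup>+x. ennreal (g x) * indicator A x \<partial>M)"
    by (intro nn_integral_cong) (auto simp: indicator_def)
  finally show ?thesis using assms(1,3) ennreal_le_iff by metis
next
  case False
  then show ?thesis
    using assms(1) by (simp add: set_lebesgue_integral_def set_integrable_def not_integrable_integral_eq)
qed

section \<open>Admissible constants from a test function\<close>

lemma hardy_bound_test_function:
  fixes \<phi> p :: "real \<Rightarrow> real"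
  assumes ab: "0 < a" "a < b" and \<mu>: "0 < \<mu>"
    and [measurable]: "\<phi> \<in> borel_measurable borel" "p \<in> borel_measurable borel"
    and \<phi>a: "\<phi> a = 0" and pos: "\<And>x. x \<in> {a..b} \<Longrightarrow> 0 < p x"
    and d\<phi>: "\<And>x. x \<in> {a..b} \<Longrightarrow> (\<phi> has_real_derivative p x) (at x)"
    and dp: "\<And>x. x \<in> {a..b} \<Longrightarrow> (p has_real_derivative - (\<mu> * \<phi> x / x\<^sup>2)) (at x)"
  shows "hardy_bound a b (1 / \<mu>)"
  unfolding hardy_bound_def
proof
  fix f assume f: "f \<in> L2_on a b"
  define F where "F x = (LINT t:{a..x}|lebesgue. f t)" for x
  \<comment> \<open>Membership in \<open>L2_on\<close> controls \<open>f\<close> only on the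
    interval; the cut-off \<open>h\<close> is measurable on the whole line.\<close>
  define h where "h t = indicator {a..b} t * f t" for t
  have h[measurable]: "h \<in> borel_measurable lebesgue"
    using f by (simp add: L2_on_def set_borel_measurable_def h_def[abs_def])
  have \<phi>L[measurable]: "\<phi> \<in> borel_measurable lebesgue" "p \<in> borel_measurable lebesgue"
    by (auto intro: measurable_completion)
  have idm[measurable]: "(\<lambda>x. x) \<in> lebesgue \<rightarrow>\<^sub>M (borel :: real measure)"
    by (intro measurable_completion) simp
  have f2: "set_integrable lebesgue {a..b} (\<lambda>x. (f x)\<^sup>2)"
    using f by (simp add: L2_on_def)
  have contp: "continuous_on {a..b} p"
    using dp by (meson DERIV_isCont continuous_at_imp_continuous_on)
  have \<phi>pos: "0 < \<phi> x" if "x \<in> {a<..b}" for x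
  proof -
    have "\<exists>y. (\<phi> has_real_derivative y) (at t) \<and> 0 < y" if "t \<in> {a..b}" for t
      using that d\<phi> pos by blast
    then have "\<phi> a < \<phi> x"
      using that by (intro DERIV_pos_imp_increasing[of a x \<phi>]) auto
    then show ?thesis using \<phi>a by simp
  qed
  then have \<phi>nn: "0 \<le> \<phi> x" if "x \<in> {a..b}" for x
    using that \<phi>a by (cases "x = a") (auto simp: less_imp_le)
  \<comment> \<open>The minimum of the weight is positive, so \<open>f\<^sup>2 / p\<close> is
    dominated by a multiple of \<open>f\<^sup>2\<close>.\<close>
  obtain m where m: "m \<in> {a..b}" "\<And>x. x \<in> {a..b} \<Longrightarrow> p m \<le> p x"
    using continuous_attains_inf[OF compact_Icc _ contp] ab by auto
  have q: "set_integrable lebesgue {a..b} (\<lambda>t. (f t)\<^sup>2 / p t)"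
  proof (rule set_integrable_bound)
    show "set_integrable lebesgue {a..b} (\<lambda>t. (1 / p m) * (f t)\<^sup>2)"
      using f2 by auto
    have "(\<lambda>t. indicator {a..b} t *\<^sub>R ((f t)\<^sup>2 / p t)) = (\<lambda>t. (h t)\<^sup>2 / p t)"
      by (auto simp: h_def indicator_def)
    then show "set_borel_measurable lebesgue {a..b} (\<lambda>t. (f t)\<^sup>2 / p t)"
      by (simp add: set_borel_measurable_def)
    have "(f t)\<^sup>2 / p t \<le> (f t)\<^sup>2 / p m" if "t \<in> {a..b}" for t
      using that m pos[OF m(1)] pos[OF that] by (intro divide_left_mono) auto
    then show "AE t in lebesgue. t \<in> {a..b} \<longrightarrow> norm ((f t)\<^sup>2 / p t) \<le> norm (1 / p m * (f t)\<^sup>2)"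
      using m pos by (intro AE_I2) (auto simp: abs_of_pos)
  qed
  \<comment> \<open>The integrand for Tonelli, supported on the triangle
    \<open>a \<le> t \<le> x \<le> b\<close>. Integrating over \<open>t\<close> first bounds the
    squared average; integrating over \<open>x\<close> first makes the weight cancel.\<close>
  define k where "k x t = ennreal (\<phi> x / x\<^sup>2 * indicator {a..b} x) * ennreal ((h t)\<^sup>2 / p t)
     * (if t \<le> x then 1 else 0)" for x t
  have inner_le: "ennreal ((1 / x * F x)\<^sup>2) * indicator {a..b} x \<le> (\<integral>\<^sup>+t. k x t \<partial>lebesgue)" for x
  proof (cases "x \<in> {a<..b}")
    case True
    have sub: "{a..x} \<subseteq> {a..b}" "{a..x} \<in> sets lebesgue" using True by auto
    have pI: "set_integrable lebesgue {a..x} p" "(LINT t:{a..x}|lebesgue. p t) = \<phi> x"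
      using set_lebesgue_integral_FTC[of a x p \<phi>] True d\<phi> \<phi>a continuous_on_subset[OF contp sub(1)]
      by auto
    have qI: "set_integrable lebesgue {a..x} (\<lambda>t. (f t)\<^sup>2 / p t)"
      using set_integrable_subset[OF q] sub by blast
    have \<phi>x: "0 < \<phi> x" using \<phi>pos True .
    \<comment> \<open>The first Cauchy-Schwarz factor is the integral of \<open>p\<close> over
      \<open>{a..x}\<close>, which equals \<open>\<phi> x\<close> because
      \<open>\<phi> a = 0\<close>.\<close>
    have "(F x)\<^sup>2 \<le> \<phi> x * (LINT t:{a..x}|lebesgue. (f t)\<^sup>2 / p t)"
      unfolding F_def pI(2)[symmetric]
      using \<phi>x pI pos sub qI set_integrable_subset[OF L2_on_set_integrable[OF f]]
      by (intro set_integral_Cauchy_Schwarz_weighted) auto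
    then have "(1 / x * F x)\<^sup>2 \<le> \<phi> x / x\<^sup>2 * (LINT t:{a..x}|lebesgue. (f t)\<^sup>2 / p t)"
      using True ab by (simp add: power_mult_distrib power_divide divide_right_mono)
    then have "ennreal ((1 / x * F x)\<^sup>2)
        \<le> ennreal (\<phi> x / x\<^sup>2) * ennreal (LINT t:{a..x}|lebesgue. (f t)\<^sup>2 / p t)"
      using \<phi>x by (subst ennreal_mult'[symmetric]) (auto intro: ennreal_leI)
    also have "ennreal (LINT t:{a..x}|lebesgue. (f t)\<^sup>2 / p t)
        = (\<integral>\<^sup>+t. ennreal (indicator {a..x} t *\<^sub>R ((f t)\<^sup>2 / p t)) \<partial>lebesgue)"
      unfolding set_lebesgue_integral_def using qI pos sub
      by (intro nn_integral_eq_integral[symmetric])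
         (auto simp: set_integrable_def indicator_def less_imp_le subset_iff)
    also have "\<dots> = (\<integral>\<^sup>+t. ennreal ((h t)\<^sup>2 / p t) * (if t \<le> x then 1 else 0) \<partial>lebesgue)"
      using sub by (intro nn_integral_cong) (auto simp: h_def indicator_def)
    also have "ennreal (\<phi> x / x\<^sup>2) * \<dots> = (\<integral>\<^sup>+t. k x t \<partial>lebesgue)"
      using True unfolding k_def
      by (subst nn_integral_cmult[symmetric]) (auto simp: mult.assoc)
    finally show ?thesis using True by simp
  next
    case False
    \<comment> \<open>The endpoint \<open>x = a\<close> is separate: there the weight has integral
      0, so Cauchy-Schwarz in the form above does not apply. Outside \<open>{a..b}\<close> the
      indicator makes the left side 0.\<close>
    have "F a = 0"
      unfolding F_def set_lebesgue_integral_def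
      by (rule integral_eq_zero_AE, rule AE_mp[OF AE_completion[OF AE_lborel_singleton[of a]]]) auto
    then show ?thesis using False by (cases "x = a") auto
  qed
  \<comment> \<open>\<open>- p / \<mu>\<close> is an antiderivative of
    \<open>\<phi> x / x\<^sup>2\<close>, so the integral over \<open>{t..b}\<close> is
    \<open>(p t - p b) / \<mu>\<close>. Dropping \<open>p b > 0\<close> leaves
    \<open>p t / \<mu>\<close>, whose factor \<open>p t\<close> cancels the denominator of
    \<open>(h t)\<^sup>2 / p t\<close>.\<close>
  have outer_le: "(\<integral>\<^sup>+x. k x t \<partial>lebesgue) \<le> ennreal (1 / \<mu>) * ennreal ((h t)\<^sup>2)" for t
  proof (cases "t \<in> {a..b}")
    case True
    have "(\<integral>\<^sup>+x. k x t \<partial>lebesgue)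
        = (\<integral>\<^sup>+x. ennreal ((h t)\<^sup>2 / p t) * (ennreal (\<phi> x / x\<^sup>2) * indicator {t..b} x) \<partial>lebesgue)"
      unfolding k_def using True by (intro nn_integral_cong) (auto simp: indicator_def mult.commute)
    also have "\<dots> = ennreal ((h t)\<^sup>2 / p t) * (\<integral>\<^sup>+x. ennreal (\<phi> x / x\<^sup>2) * indicator {t..b} x \<partial>lborel)"
      unfolding nn_integral_completion by (intro nn_integral_cmult) auto
    also have "(\<integral>\<^sup>+x. ennreal (\<phi> x / x\<^sup>2) * indicator {t..b} x \<partial>lborel) = ennreal (- (p b / \<mu>) - - (p t / \<mu>))"
    proof (rule nn_integral_FTC_Icc)
      fix x assume x: "x \<in> {t..b}"
      then have "((\<lambda>x. - (p x / \<mu>)) has_real_derivative - (- (\<mu> * \<phi> x / x\<^sup>2) / \<mu>)) (at x)"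
        using True by (intro DERIV_minus DERIV_cdivide dp) auto
      moreover have "- (- (\<mu> * \<phi> x / x\<^sup>2) / \<mu>) = \<phi> x / x\<^sup>2" using \<mu> by simp
      ultimately show "((\<lambda>x. - (p x / \<mu>)) has_real_derivative \<phi> x / x\<^sup>2) (at x)"
        by simp
      show "0 \<le> \<phi> x / x\<^sup>2" using \<phi>nn[of x] x True by auto
    qed (use True in auto)
    also have "\<dots> \<le> ennreal (p t / \<mu>)"
      using pos[of b] ab \<mu> by (intro ennreal_leI) auto
    also have "ennreal ((h t)\<^sup>2 / p t) * ennreal (p t / \<mu>) = ennreal (1 / \<mu>) * ennreal ((h t)\<^sup>2)"
      using pos[OF True] \<mu> by (simp add: ennreal_mult'[symmetric] mult.commute)
    finally show ?thesis by (simp add: mult_left_mono)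
  qed (auto simp: k_def h_def)
  \<comment> \<open>Tonelli requires sigma-finiteness, which \<open>lebesgue\<close> inherits as the
    completion of \<open>lborel\<close>.\<close>
  interpret L: sigma_finite_measure "lebesgue :: real measure"
    by (intro sigma_finite_measure_completion lborel.sigma_finite_measure_axioms)
  interpret P: pair_sigma_finite "lebesgue :: real measure" "lebesgue :: real measure" ..
  have [measurable]: "fst \<in> (lebesgue \<Otimes>\<^sub>M lebesgue) \<rightarrow>\<^sub>M (borel :: real measure)"
    "snd \<in> (lebesgue \<Otimes>\<^sub>M lebesgue) \<rightarrow>\<^sub>M (borel :: real measure)"
    using measurable_compose[OF measurable_fst idm] measurable_compose[OF measurable_snd idm] by auto
  have kmeas: "case_prod k \<in> borel_measurable (lebesgue \<Otimes>\<^sub>M lebesgue)"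
    unfolding k_def by measurable
  have "(\<integral>\<^sup>+x. ennreal ((1 / x * F x)\<^sup>2) * indicator {a..b} x \<partial>lebesgue)
      \<le> (\<integral>\<^sup>+x. \<integral>\<^sup>+t. k x t \<partial>lebesgue \<partial>lebesgue)"
    by (intro nn_integral_mono inner_le)
  also have "\<dots> = (\<integral>\<^sup>+t. \<integral>\<^sup>+x. k x t \<partial>lebesgue \<partial>lebesgue)"
    using P.Fubini'[OF kmeas] by simp
  also have "\<dots> \<le> (\<integral>\<^sup>+t. ennreal (1 / \<mu>) * ennreal ((h t)\<^sup>2) \<partial>lebesgue)"
    by (intro nn_integral_mono outer_le)
  also have "\<dots> = ennreal (1 / \<mu>) * (\<integral>\<^sup>+t. ennreal ((h t)\<^sup>2) \<partial>lebesgue)"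
    by (intro nn_integral_cmult) auto
  also have "(\<integral>\<^sup>+t. ennreal ((h t)\<^sup>2) \<partial>lebesgue)
      = (\<integral>\<^sup>+t. ennreal (indicator {a..b} t *\<^sub>R (f t)\<^sup>2) \<partial>lebesgue)"
    by (intro nn_integral_cong) (auto simp: h_def indicator_def)
  also have "\<dots> = ennreal (LINT t:{a..b}|lebesgue. (f t)\<^sup>2)"
    unfolding set_lebesgue_integral_def using f2
    by (intro nn_integral_eq_integral) (auto simp: set_integrable_def)
  also have "ennreal (1 / \<mu>) * \<dots> = ennreal (1 / \<mu> * (LINT t:{a..b}|lebesgue. (f t)\<^sup>2))"
    using \<mu> by (intro ennreal_mult'[symmetric]) simp
  finally show "(LINT x:{a..b}|lebesgue. (1 / x * (LINT t:{a..x}|lebesgue. f t))\<^sup>2)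
      \<le> 1 / \<mu> * (LINT x:{a..b}|lebesgue. (f x)\<^sup>2)"
    unfolding F_def using \<mu>
    by (intro set_integral_le_nn_integral_bound)
       (auto intro!: mult_nonneg_nonneg integral_nonneg_AE simp: set_lebesgue_integral_def)
qed

section \<open>Existence of the smallest constant\<close>

lemma hardy_const_least:
  assumes bdd: "\<And>C. hardy_bound a b C \<Longrightarrow> B \<le> C" and ex: "hardy_bound a b C0"
  shows "hardy_bound a b (hardy_const a b)"
    and "hardy_bound a b C \<Longrightarrow> hardy_const a b \<le> C"
proof -
  let ?S = "{C. hardy_bound a b C}"
  \<comment> \<open>\<open>LEAST\<close> on the reals is informative only once a minimum is
    exhibited; the infimum is one. For each \<open>f\<close> with \<open>?N > 0\<close> the quotient
    \<open>?A / ?N\<close> is a lower bound of the admissible constants, hence at most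
    \<open>d\<close>. If \<open>?N = 0\<close>, any admissible constant already forces
    \<open>?A \<le> 0\<close>.\<close>
  define d where "d = Inf ?S"
  have S: "?S \<noteq> {}" "bdd_below ?S" using assms by (auto intro!: bdd_belowI)
  have d: "hardy_bound a b d"
    unfolding hardy_bound_def
  proof
    fix f assume f: "f \<in> L2_on a b"
    let ?A = "LINT x:{a..b}|lebesgue. (1 / x * (LINT t:{a..x}|lebesgue. f t))\<^sup>2"
    let ?N = "LINT x:{a..b}|lebesgue. (f x)\<^sup>2"
    have le: "?A \<le> C * ?N" if "hardy_bound a b C" for C
      using that f by (auto simp: hardy_bound_def)
    have "0 \<le> ?N"
      unfolding set_lebesgue_integral_def by (intro integral_nonneg_AE) simp
    then consider "?N = 0" | "0 < ?N" by linarith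
    then show "?A \<le> d * ?N"
    proof cases
      case 1
      then show ?thesis using le[OF ex] by simp
    next
      case 2
      have "?A / ?N \<le> d"
        unfolding d_def using 2 le S by (intro cInf_greatest) (auto simp: pos_divide_le_eq)
      then show ?thesis using 2 by (simp add: pos_divide_le_eq)
    qed
  qed
  have "hardy_const a b = d"
    unfolding hardy_const_def using d S by (intro Least_equality) (auto simp: d_def intro: cInf_lower)
  then show "hardy_bound a b (hardy_const a b)"
    and "hardy_bound a b C \<Longrightarrow> hardy_const a b \<le> C"
    using d S by (auto simp: d_def intro: cInf_lower)
qed

section \<open>Solutions of the Euler equation
  \<open>x\<^sup>2 \<phi>'' + (1/4 + \<omega>\<^sup>2) \<phi> = 0\<close> and the bounds they
  give\<close>

definition hardy_fun :: "real \<Rightarrow> real \<Rightarrow> real \<Rightarrow> real" where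
  "hardy_fun \<omega> a x = sqrt x * sin (\<omega> * (ln x - ln a))"

definition hardy_fun' :: "real \<Rightarrow> real \<Rightarrow> real \<Rightarrow> real" where
  "hardy_fun' \<omega> a x = (sin (\<omega> * (ln x - ln a)) / 2 + \<omega> * cos (\<omega> * (ln x - ln a))) / sqrt x"

lemma hardy_fun_measurable [measurable]:
  "hardy_fun \<omega> a \<in> borel_measurable borel" "hardy_fun' \<omega> a \<in> borel_measurable borel"
  unfolding hardy_fun_def[abs_def] hardy_fun'_def[abs_def] by measurable

lemma DERIV_hardy_fun:
  assumes "0 < x"
  shows "(hardy_fun \<omega> a has_real_derivative hardy_fun' \<omega> a x) (at x)"
proof -
  \<comment> \<open>Writing \<open>x = y\<^sup>2\<close> makes both forms of the derivative rational
    in \<open>y\<close>, \<open>S\<close> and \<open>K\<close>.\<close>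
  define y where "y = sqrt x"
  define S where "S = sin (\<omega> * (ln x - ln a))"
  define K where "K = cos (\<omega> * (ln x - ln a))"
  have y: "0 < y" "x = y\<^sup>2" using assms by (auto simp: y_def)
  have "(hardy_fun \<omega> a has_real_derivative inverse y / 2 * S + K * (\<omega> * (1 / x)) * y) (at x)"
    unfolding hardy_fun_def[abs_def] y_def S_def K_def
    using assms by (auto intro!: derivative_eq_intros)
  also have "inverse y / 2 * S + K * (\<omega> * (1 / x)) * y = (S / 2 + \<omega> * K) / y"
    using y by (simp add: field_simps power2_eq_square)
  finally show ?thesis by (simp add: hardy_fun'_def y_def S_def K_def)
qed

lemma DERIV_hardy_fun':
  assumes "0 < x"
  shows "(hardy_fun' \<omega> a has_real_derivative - ((1/4 + \<omega>\<^sup>2) * hardy_fun \<omega> a x / x\<^sup>2)) (at x)"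
proof -
  define y where "y = sqrt x"
  define S where "S = sin (\<omega> * (ln x - ln a))"
  define K where "K = cos (\<omega> * (ln x - ln a))"
  have y: "0 < y" "x = y\<^sup>2" using assms by (auto simp: y_def)
  let ?d = "((K * (\<omega> * (1 / x)) / 2 - \<omega> * (S * (\<omega> * (1 / x)))) * y
              - (S / 2 + \<omega> * K) * (inverse y / 2)) / (y * y)"
  have "(hardy_fun' \<omega> a has_real_derivative ?d) (at x)"
    unfolding hardy_fun'_def[abs_def] y_def S_def K_def
    using assms by (auto intro!: derivative_eq_intros simp: mult_ac)
  \<comment> \<open>The two cosine terms cancel; this is the effect of the factor
    \<open>sqrt x\<close> in \<open>hardy_fun\<close>.\<close>
  also have "?d = - ((1/4 + \<omega>\<^sup>2) * (y * S) / x\<^sup>2)"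
    using y by (simp add: field_simps power2_eq_square)
  finally show ?thesis by (simp add: hardy_fun_def y_def S_def K_def)
qed

text \<open>With this frequency the phase runs through \<open>[0, pi/2]\<close>, where sine and
  cosine are nonnegative and never both 0. Hence the derivative of the test function is positive up
  to \<open>b\<close>.\<close>

lemma hardy_bound_quarter_period:
  assumes "0 < a" "a < b"
  shows "hardy_bound a b (1 / (1/4 + (pi / (2 * ln (b / a)))\<^sup>2))"
proof -
  define \<omega> where "\<omega> = pi / (2 * ln (b / a))"
  have T: "0 < ln (b / a)" using assms by simp
  then have \<omega>: "0 < \<omega>" by (simp add: \<omega>_def)
  have pos: "0 < hardy_fun' \<omega> a x" if x: "x \<in> {a..b}" for x
  proof -
    let ?s = "\<omega> * (ln x - ln a)"
    have "?s \<le> \<omega> * ln (b / a)"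
      using x assms \<omega> by (intro mult_left_mono) (auto simp: ln_div)
    also have "\<dots> = pi / 2" using T by (simp add: \<omega>_def)
    finally have s: "0 \<le> ?s" "?s \<le> pi / 2"
      using x assms \<omega> by auto
    then have "0 \<le> sin ?s" "0 \<le> cos ?s"
      by (auto intro: sin_ge_zero cos_ge_zero)
    moreover have "0 < sin ?s \<or> 0 < cos ?s"
      using calculation sin_cos_squared_add[of ?s] by (force simp: less_le)
    ultimately have "0 < sin ?s / 2 + \<omega> * cos ?s"
      using \<omega> by (auto intro: add_pos_nonneg add_nonneg_pos)
    then show ?thesis using x assms by (simp add: hardy_fun'_def)
  qed
  show ?thesis
    unfolding \<omega>_def[symmetric]
    using assms pos
    by (intro hardy_bound_test_function[where \<phi> = "hardy_fun \<omega> a" and p = "hardy_fun' \<omega> a"]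
          DERIV_hardy_fun DERIV_hardy_fun') (auto simp: hardy_fun_def add_pos_nonneg)
qed

text \<open>With the doubled frequency the phase reaches \<open>pi\<close> at \<open>b\<close>. The
  derivative of \<open>hardy_fun\<close> then turns the ratio of the two sides of Hardy's inequality
  into exactly \<open>1 / \<mu>\<close>.\<close>

lemma hardy_bound_lower:
  assumes ab: "0 < a" "a < b" and C: "hardy_bound a b C"
  shows "1 / (1/4 + (pi / ln (b / a))\<^sup>2) \<le> C"
proof -
  define \<omega> where "\<omega> = pi / ln (b / a)"
  define \<mu> where "\<mu> = 1/4 + \<omega>\<^sup>2"
  let ?F = "hardy_fun \<omega> a" and ?f = "hardy_fun' \<omega> a"
  have T: "0 < ln (b / a)" using ab by simp
  have \<mu>: "0 < \<mu>" by (simp add: \<mu>_def add_pos_nonneg)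
  have F0: "?F a = 0" "?F b = 0"
    using T ab by (auto simp: hardy_fun_def \<omega>_def ln_div)
  have contF: "continuous_on {a..b} ?F" and contf: "continuous_on {a..b} ?f"
    using ab DERIV_isCont[OF DERIV_hardy_fun] DERIV_isCont[OF DERIV_hardy_fun']
    by (auto intro!: continuous_at_imp_continuous_on)
  define g where "g x = (1 / x * ?F x)\<^sup>2" for x
  have contg: "continuous_on {a..b} g"
    unfolding g_def using ab by (intro continuous_intros contF) auto
  have contf2: "continuous_on {a..b} (\<lambda>x. (?f x)\<^sup>2)"
    by (intro continuous_intros contf)
  have gI: "set_integrable lebesgue {a..b} g"
    and f2I: "set_integrable lebesgue {a..b} (\<lambda>x. (?f x)\<^sup>2)"
    using contg contf2 by (auto intro: absolutely_integrable_continuous_real)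
  \<comment> \<open>Integration by parts: the integrand is the derivative of \<open>?F * ?f\<close>,
    because \<open>?f' = - \<mu> * ?F / x\<^sup>2\<close>. The boundary terms vanish by
    \<open>F0\<close>.\<close>
  have "(LINT x:{a..b}|lebesgue. (?f x)\<^sup>2 - \<mu> * g x) = ?F b * ?f b - ?F a * ?f a"
  proof (rule set_lebesgue_integral_FTC)
    show "continuous_on {a..b} (\<lambda>x. (?f x)\<^sup>2 - \<mu> * g x)"
      by (intro continuous_intros contf2 contg)
    fix x assume "x \<in> {a..b}"
    then have "0 < x" using ab by simp
    then show "((\<lambda>x. ?F x * ?f x) has_real_derivative (?f x)\<^sup>2 - \<mu> * g x) (at x)"
      by (auto intro!: derivative_eq_intros DERIV_hardy_fun DERIV_hardy_fun'
          simp: g_def \<mu>_def field_simps power2_eq_square)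
  qed (use ab in auto)
  then have parts: "(LINT x:{a..b}|lebesgue. (?f x)\<^sup>2) = \<mu> * (LINT x:{a..b}|lebesgue. g x)"
    using gI f2I F0 by simp
  \<comment> \<open>A continuous nonnegative function with integral 0 vanishes identically. At the
    geometric mean of \<open>a\<close> and \<open>b\<close> the phase is \<open>pi/2\<close>, so the
    sine is 1 and \<open>g\<close> is not 0.\<close>
  have "integral {a..b} g \<noteq> 0"
  proof
    assume "integral {a..b} g = 0"
    then have z: "\<forall>x\<in>{a..b}. g x = 0"
      using integral_eq_0_iff[of a b g] contg ab by (auto simp: g_def)
    let ?m = "sqrt (a * b)"
    have m: "?m \<in> {a..b}" "0 < ?m"
      using ab real_sqrt_le_mono[of "a * a" "a * b"] real_sqrt_le_mono[of "a * b" "b * b"] by auto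
    have "pi / ln (b / a) * (ln ?m - ln a) = pi / 2"
      using T ab by (simp add: ln_sqrt ln_mult ln_div field_simps)
    then have "?F ?m = sqrt ?m"
      unfolding hardy_fun_def \<omega>_def by (simp only: sin_pi_half mult_1_right)
    then show False using z[rule_format, OF m(1)] m(2) ab by (simp add: g_def)
  qed
  moreover have "(LINT x:{a..b}|lebesgue. g x) = integral {a..b} g"
    using set_lebesgue_integral_eq_integral(2)[OF gI] .
  moreover have "0 \<le> (LINT x:{a..b}|lebesgue. g x)"
    unfolding set_lebesgue_integral_def by (intro integral_nonneg_AE) (simp add: g_def)
  ultimately have gpos: "0 < (LINT x:{a..b}|lebesgue. g x)" by linarith
  have "?f \<in> L2_on a b"
    using f2I absolutely_integrable_continuous_real[OF contf]
    by (auto simp: L2_on_def set_integrable_def set_borel_measurable_def)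
  then have "(LINT x:{a..b}|lebesgue. (1 / x * (LINT t:{a..x}|lebesgue. ?f t))\<^sup>2)
      \<le> C * (LINT x:{a..b}|lebesgue. (?f x)\<^sup>2)"
    using C by (simp add: hardy_bound_def)
  also have "(LINT x:{a..b}|lebesgue. (1 / x * (LINT t:{a..x}|lebesgue. ?f t))\<^sup>2)
      = (LINT x:{a..b}|lebesgue. g x)"
  proof (intro set_lebesgue_integral_cong ballI allI impI)
    fix x assume x: "x \<in> {a..b}"
    have "(LINT t:{a..x}|lebesgue. ?f t) = ?F x - ?F a"
      using x ab by (intro set_lebesgue_integral_FTC(2) DERIV_hardy_fun)
        (auto intro: continuous_on_subset[OF contf])
    then show "(1 / x * (LINT t:{a..x}|lebesgue. ?f t))\<^sup>2 = g x"
      using F0 by (simp add: g_def)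
  qed auto
  \<comment> \<open>The inequality reads
    \<open>\<integral> g \<le> C * \<mu> * \<integral> g\<close>, and the positive integral of
    \<open>g\<close> cancels.\<close>
  finally have "1 \<le> C * \<mu>"
    using gpos by (simp add: parts mult.assoc[symmetric])
  then show ?thesis
    using \<mu> by (simp add: \<mu>_def \<omega>_def pos_divide_le_eq)
qed

section \<open>Asymptotic form of the two bounds\<close>

theorem corollary1p2:
  shows "\<exists>c1 > (0::real). \<exists>c2 > (0::real). \<exists>L :: real. \<forall>a b :: real.
           0 < a \<and> a < b \<and> ln (b / a) \<ge> L \<longrightarrow>
             4 - c1 / (ln (b / a))\<^sup>2 \<le> hardy_const a b \<and>
             hardy_const a b \<le> 4 - c2 / (ln (b / a))\<^sup>2"
proof -
  \<comment> \<open>With \<open>u = (pi / ln (b / a))\<^sup>2\<close> the bounds are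
    \<open>4 / (1 + 4 * u)\<close> and \<open>4 / (1 + u)\<close>. The first is at least
    \<open>4 - 16 * u\<close> for every \<open>u \<ge> 0\<close>. The second is at most
    \<open>4 - 2 * u\<close> when \<open>0 \<le> u \<le> 1\<close>, since
    \<open>(4 - 2 * u) * (1 + u) = 4 + 2 * u * (1 - u)\<close>; this fixes the threshold
    \<open>pi\<close>.\<close>
  have "4 - 16 * pi\<^sup>2 / (ln (b / a))\<^sup>2 \<le> hardy_const a b \<and>
        hardy_const a b \<le> 4 - 2 * pi\<^sup>2 / (ln (b / a))\<^sup>2"
    if ab: "0 < a" "a < b" "pi \<le> ln (b / a)" for a b :: real
  proof -
    define u where "u = (pi / ln (b / a))\<^sup>2"
    have u: "0 \<le> u" "u \<le> 1"
      using ab pi_gt_zero by (auto simp: u_def power_le_one_iff)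
    have upper: "hardy_bound a b (1 / (1/4 + u / 4))"
      using hardy_bound_quarter_period[OF ab(1,2)] by (simp add: u_def power_divide power_mult_distrib mult.commute)
    have lower: "1 / (1/4 + u) \<le> C" if "hardy_bound a b C" for C
      using hardy_bound_lower[OF ab(1,2) that] by (simp add: u_def)
    have hc: "hardy_bound a b (hardy_const a b)"
      using hardy_const_least(1)[OF lower upper] .
    have "4 - 16 * u \<le> 1 / (1/4 + u)"
      using u by (simp add: field_simps)
    also have "\<dots> \<le> hardy_const a b" using lower[OF hc] .
    finally have 1: "4 - 16 * u \<le> hardy_const a b" .
    have "hardy_const a b \<le> 1 / (1/4 + u / 4)"
      using hardy_const_least(2)[OF lower upper upper] .
    also have "\<dots> \<le> 4 - 2 * u"
      using u mult_left_le[of u u] by (simp add: field_simps)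
    finally have 2: "hardy_const a b \<le> 4 - 2 * u" .
    show ?thesis using 1 2 by (simp add: u_def power_divide)
  qed
  then show ?thesis
    by (intro exI[of _ "16 * pi\<^sup>2"] exI[of _ "2 * pi\<^sup>2"] exI[of _ pi] conjI) auto
qed

end
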